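(* Let $G$ be an abelian group and let $A$ be a finite sequence of elements of $G$ with $|A|>|S(A)|$, and let $k$ be an integer with $2\leqslant k\leqslant |A|-2$. Then \[|k\wedge A|\geqslant |S(A)|,\] with equality if and only if one of the following holds: (i) $S(A)$ is a coset of a subgroup of $G$; (ii) $|S(A)|=2$ and $|S_2(A)|=1$; (iii) $S(A)$ is an arithmetic progression of length three, $\{x,x+d,x+2d\}$ with three distinct elements, and $S_2(A)=\{x+d\}$ (it contains only the middle term).
   Context: A sequence over $G$ is a finite multiset of elements of $G$; $|A|$ is its number of terms (counted with multiplicity). $S(A)$ is the support of $A$ (set of distinct elements appearing in $A$), and $S_j(A)$ is the set of elements appearing at least $j$ times in $A$. $k\wedge A$ is the set of all sums $a_{i_1}+\dots+a_{i_k}$ of $k$ terms of $A$ taken at $k$ distinct positions (i.e. sums of subsequences of length $k$). *)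

theory Defs
  imports Complex_Main "HOL-Library.Multiset"
begin

definition is_subgroup :: "'a::ab_group_add set \<Rightarrow> bool" where
  "is_subgroup H \<longleftrightarrow>
     0 \<in> H \<and> (\<forall>x\<in>H. \<forall>y\<in>H. x + y \<in> H) \<and> (\<forall>x\<in>H. - x \<in> H)"

definition is_subgroup_coset :: "'a::ab_group_add set \<Rightarrow> bool" where
  "is_subgroup_coset S \<longleftrightarrow> (\<exists>g H. is_subgroup H \<and> S = (\<lambda>h. g + h) ` H)"

definition mult_support :: "nat \<Rightarrow> 'a multiset \<Rightarrow> 'a set" where
  "mult_support j A = {x \<in> set_mset A. j \<le> count A x}"

text \<open>Choosing \<open>k\<close> distinct positions of a sequence is choosing a sub-multiset of size \<open>k\<close>,
  so repeated terms may be used up to their multiplicity.\<close>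

definition ksums :: "nat \<Rightarrow> 'a::ab_group_add multiset \<Rightarrow> 'a set" where
  "ksums k A = {sum_mset B | B. B \<subseteq># A \<and> size B = k}"

end

theory Submission
  imports Defs
begin

text \<open>
  Translate a repeated term to \<open>0\<close> and discard other repetitions: it suffices to bound the set
  \<open>K\<close> of \<open>k\<close>-term sums of \<open>T \<union> {0, 0}\<close> with \<open>0 \<notin> T\<close>, by induction on \<open>card T\<close>. By complementation
  \<open>k\<close> may be taken at most half of the length; \<open>k = 2\<close> asks for sets closed under sums of distinct
  elements. For \<open>k \<ge> 3\<close> in the extremal case, the induction hypothesis forces
  \<open>K = t + M\<^sub>t\<close> for every \<open>t \<in> T\<close>, where \<open>M\<^sub>t\<close> is the set of \<open>(k - 1)\<close>-term sums avoiding \<open>t\<close>, and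
  these translates \<open>M\<^sub>t\<close> of \<open>K\<close> pairwise differ in at most one element. Either all coincide, and \<open>K\<close> is a
  coset of the group \<open>T \<union> {0}\<close>, or all have the form \<open>J - {j\<^sub>t}\<close>. In the latter case \<open>J\<close> turns out to
  be a coset of a group \<open>L = T \<union> {0, h}\<close>, but then \<open>K = L\<close>, which is too large.
\<close>

section \<open>Subgroups and finite sets closed under sums of distinct elements\<close>

lemma card_translate [simp]: "card ((+) (a::'a::ab_group_add) ` X) = card X"
  by (simp add: card_image)

lemma translate_minus_mem: "x \<in> (+) (a::'a::ab_group_add) ` X \<longleftrightarrow> x - a \<in> X"
  by (force simp: image_iff intro: bexI[of _ "x - a"])

lemma is_subgroup_diff: "is_subgroup H \<Longrightarrow> x \<in> H \<Longrightarrow> y \<in> H \<Longrightarrow> x - y \<in> H"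
  unfolding is_subgroup_def by (metis add_uminus_conv_diff)

lemma is_subgroup_sum:
  assumes "is_subgroup H" "B \<subseteq> H"
  shows "\<Sum>B \<in> H"
  using assms(2) by (induction B rule: infinite_finite_induct)
    (use assms(1) in \<open>auto simp: is_subgroup_def\<close>)

lemma finite_closed_is_subgroup:
  assumes "finite S" "0 \<in> S" and closed: "\<And>x y. x \<in> S \<Longrightarrow> y \<in> S \<Longrightarrow> x + y \<in> S"
  shows "is_subgroup S"
proof -
  have "- x \<in> S" if x: "x \<in> S" for x
  proof -
    have "(+) x ` S = S"
      by (rule card_subset_eq) (use assms x in auto)
    then have "0 \<in> (+) x ` S" using assms(2) by simp
    then show ?thesis by (simp add: translate_minus_mem)
  qed
  then show ?thesis using assms by (auto simp: is_subgroup_def)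
qed

text \<open>Let \<open>x + x\<close> leave \<open>S\<close>. By \<open>neg\<close>, no
  \<open>y\<close> in \<open>S\<close> outside \<open>{0, x, - x}\<close> has \<open>- y\<close> in
  \<open>S\<close>; by \<open>pred\<close>, if \<open>- x\<close> is missing, subtracting
  \<open>x\<close> maps \<open>S - {0}\<close> into \<open>S\<close>. For such a \<open>y\<close>,
  also \<open>y + y\<close> leaves \<open>S\<close>, since otherwise translation by \<open>y\<close>
  would permute \<open>S\<close>. By symmetry both \<open>y - x\<close> and \<open>x - y\<close> lie
  in \<open>S\<close>, against \<open>neg\<close>.\<close>

lemma closed_under_distinct_sums:
  fixes S :: "'a::ab_group_add set"
  assumes fin: "finite S" and zero: "0 \<in> S"
    and cl: "\<And>x y. x \<in> S \<Longrightarrow> y \<in> S \<Longrightarrow> x \<noteq> y \<Longrightarrow> x + y \<in> S"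
  shows "is_subgroup S \<or> (\<exists>x\<in>S. x + x \<notin> S \<and> S \<subseteq> {0, x, - x})"
proof (cases "\<forall>x\<in>S. x + x \<in> S")
  case True
  then have "is_subgroup S" using finite_closed_is_subgroup[OF fin zero] cl by metis
  then show ?thesis ..
next
  case False
  then obtain x where x: "x \<in> S" "x + x \<notin> S" by blast
  have neg: "- y \<notin> S" if h: "x \<in> S" "x + x \<notin> S" "y \<in> S" "y \<noteq> 0" "y \<noteq> x" "y \<noteq> - x" for x y
  proof
    assume my: "- y \<in> S"
    have xy: "x + y \<in> S" using cl h by metis
    show False
    \<comment> \<open>\<open>x + x\<close> is \<open>(x + y) + (x - y)\<close>, a sum of distinct
      elements unless \<open>y\<close> is an involution; then it is reached as
      \<open>x + (x + y) + y\<close>.\<close>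
    proof (cases "y + y = 0")
      case True
      have "x + (x + y) \<in> S" using cl[of x "x + y"] h xy by auto
      moreover have "x + (x + y) \<noteq> y" using h(2) zero by (metis add.assoc add_cancel_left_left)
      ultimately have "x + (x + y) + y \<in> S" using cl h by blast
      then show False using h(2) True by (simp add: add.assoc)
    next
      case False
      have "x + (- y) \<in> S" using cl[of x "- y"] h my by (metis minus_minus)
      moreover have "x + y \<noteq> x + (- y)" using False by (metis add_left_cancel add.right_inverse)
      ultimately have "x + y + (x + (- y)) \<in> S" using cl xy by blast
      then show False using h(2) by (simp add: algebra_simps)
    qed
  qed
  have pred: "y - x \<in> S" if h: "x \<in> S" "x + x \<notin> S" "- x \<notin> S" "y \<in> S" "y \<noteq> 0" for x y
  proof -
    \<comment> \<open>Translation by \<open>x\<close> loses only \<open>0\<close> and gains only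
      \<open>x + x\<close>, so counting gives equality.\<close>
    have "0 \<notin> (+) x ` S" using h by (simp add: translate_minus_mem)
    moreover have "(+) x ` S \<subseteq> insert (x + x) S" using cl h by fastforce
    ultimately have sub: "(+) x ` S \<subseteq> insert (x + x) S - {0}" by blast
    have "card (insert (x + x) S - {0}) = card S" using h fin zero by (simp add: card_Diff_singleton)
    then have "(+) x ` S = insert (x + x) S - {0}"
      by (intro card_subset_eq) (use fin sub in auto)
    then have "y \<in> (+) x ` S" using h by simp
    then show ?thesis by (simp add: translate_minus_mem)
  qed
  have "S \<subseteq> {0, x, - x}"
  proof (rule ccontr)
    assume "\<not> S \<subseteq> {0, x, - x}"
    then obtain y where y: "y \<in> S" "y \<noteq> 0" "y \<noteq> x" "y \<noteq> - x" by blast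
    have my: "- y \<notin> S" using neg x y by blast
    have yy: "y + y \<notin> S"
    proof
      assume "y + y \<in> S"
      then have "(+) y ` S \<subseteq> S" using cl y by fastforce
      then have "(+) y ` S = S" by (intro card_subset_eq) (use fin in auto)
      then show False using my zero by (metis diff_0 translate_minus_mem)
    qed
    have x0: "x \<noteq> 0" using x by auto
    have mx: "- x \<notin> S" using neg[of y x] x y yy x0 by (metis minus_minus)
    have d: "y - x \<in> S" "x - y \<in> S" using pred x y mx my yy x0 by blast+
    have "y - x \<noteq> x" using d my yy x y mx
      by (metis add_diff_cancel_left' diff_add_cancel diff_minus_eq_add minus_diff_eq)
    moreover have "y - x \<noteq> - x" using y by simp
    moreover have "y - x \<noteq> 0" using y by simp
    ultimately have "- (y - x) \<notin> S" using neg[OF x d(1)] by blast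
    then show False using d by simp
  qed
  then show ?thesis using x by blast
qed

section \<open>Sums with two zero terms\<close>

text \<open>The sums of \<open>k\<close> terms of the sequence consisting of \<open>T\<close> and two copies of \<open>0\<close>.\<close>

definition wsums :: "'a::ab_group_add set \<Rightarrow> nat \<Rightarrow> 'a set" where
  "wsums T k = {sum (\<lambda>x. x) B | B. B \<subseteq> T \<and> card B \<le> k \<and> k \<le> card B + 2}"

lemma wsumsI: "B \<subseteq> T \<Longrightarrow> card B \<le> k \<Longrightarrow> k \<le> card B + 2 \<Longrightarrow> \<Sum>B \<in> wsums T k"
  unfolding wsums_def by blast

lemma wsumsE:
  assumes "x \<in> wsums T k"
  obtains B where "B \<subseteq> T" "card B \<le> k" "k \<le> card B + 2" "x = \<Sum>B"
  using assms unfolding wsums_def by blast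

lemma finite_wsums [simp]: "finite T \<Longrightarrow> finite (wsums T k)"
proof -
  assume "finite T"
  moreover have "wsums T k \<subseteq> (\<lambda>B. \<Sum>B) ` Pow T" unfolding wsums_def by auto
  ultimately show ?thesis by (meson finite_Pow_iff finite_imageI finite_subset)
qed

lemma wsums_mono: "T \<subseteq> U \<Longrightarrow> wsums T k \<subseteq> wsums U k"
  unfolding wsums_def by blast

lemma wsums_add:
  assumes "finite T" "t \<in> T" "x \<in> wsums (T - {t}) (k - 1)" "1 \<le> k"
  shows "t + x \<in> wsums T k"
proof -
  obtain B where B: "B \<subseteq> T - {t}" "card B \<le> k - 1" "k - 1 \<le> card B + 2" "x = \<Sum>B"
    using assms(3) by (rule wsumsE)
  have fB: "finite B" using B(1) assms(1) by (meson finite_Diff finite_subset)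
  have tB: "t \<notin> B" using B(1) by blast
  have "\<Sum>(insert t B) \<in> wsums T k"
    by (rule wsumsI) (use B assms fB tB in auto)
  then show ?thesis using B(4) fB tB by simp
qed

text \<open>Passing from \<open>B\<close> to \<open>T - B\<close> turns \<open>i\<close> chosen
  zeros into \<open>2 - i\<close>, so sums of complementary lengths are reflections of each other.
  This reduces large \<open>k\<close> to at most half the length.\<close>

lemma wsums_dual:
  fixes T :: "'a::ab_group_add set"
  assumes "finite T" "k \<le> card T + 2"
  shows "wsums T (card T + 2 - k) = (\<lambda>x. \<Sum>T - x) ` wsums T k"
proof -
  have sub: "(\<lambda>x. \<Sum>T - x) ` wsums T k \<subseteq> wsums T (card T + 2 - k)"
    if k: "k \<le> card T + 2" for k
  proof clarify
    fix x assume "x \<in> wsums T k"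
    then obtain B where B: "B \<subseteq> T" "card B \<le> k" "k \<le> card B + 2" "x = \<Sum>B" by (rule wsumsE)
    have "card (T - B) = card T - card B" "card B \<le> card T"
      using B assms(1) by (auto simp: card_Diff_subset finite_subset card_mono)
    then have "\<Sum>(T - B) \<in> wsums T (card T + 2 - k)"
      by (intro wsumsI) (use B k in auto)
    then show "\<Sum>T - x \<in> wsums T (card T + 2 - k)"
      using B assms(1) by (simp add: sum_diff)
  qed
  have "wsums T (card T + 2 - k) \<subseteq> (\<lambda>x. \<Sum>T - x) ` wsums T k"
  proof
    fix y assume "y \<in> wsums T (card T + 2 - k)"
    then have "\<Sum>T - y \<in> wsums T k" using sub[of "card T + 2 - k"] assms(2) by auto
    then show "y \<in> (\<lambda>x. \<Sum>T - x) ` wsums T k" by (rule rev_image_eqI) simp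
  qed
  then show ?thesis using sub[OF assms(2)] by blast
qed

lemma card_wsums_dual:
  assumes "finite T" "k \<le> card T + 2"
  shows "card (wsums T (card T + 2 - k)) = card (wsums T k)"
  unfolding wsums_dual[OF assms] by (rule card_image) (auto intro: inj_onI)

lemma insert_zero_subset_wsums:
  fixes T :: "'a::ab_group_add set"
  assumes "k = 1 \<or> k = 2"
  shows "insert 0 T \<subseteq> wsums T k"
proof clarify
  fix x assume "x \<in> insert 0 T"
  then show "x \<in> wsums T k"
    using wsumsI[of "{}" T k] wsumsI[of "{x}" T k] assms by auto
qed

lemma wsums_subset_subgroup:
  assumes "is_subgroup H" "T \<subseteq> H"
  shows "wsums T k \<subseteq> H"
  using assms by (auto elim!: wsumsE intro!: is_subgroup_sum)

lemma wsums_pair: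
  assumes "x \<in> T" "y \<in> T" "x \<noteq> y" "2 \<le> k" "k \<le> 4"
  shows "x + y \<in> wsums T k"
  using wsumsI[of "{x, y}" T k] assms by auto

text \<open>Used to exclude a second coset inside a set of fewer than \<open>2 * card H\<close>
  elements.\<close>

lemma two_cosets_card:
  fixes H :: "'a::ab_group_add set"
  assumes "is_subgroup H" "finite K" "x - y \<notin> H" "(+) x ` H \<subseteq> K" "(+) y ` H \<subseteq> K"
  shows "2 * card H \<le> card K"
proof -
  have "(+) x ` H \<inter> (+) y ` H = {}"
  proof (rule ccontr)
    assume "(+) x ` H \<inter> (+) y ` H \<noteq> {}"
    then obtain a b where ab: "a \<in> H" "b \<in> H" "x + a = y + b" by auto
    then have "x - y = b - a" by (simp add: algebra_simps)
    then show False using is_subgroup_diff[OF assms(1) ab(2,1)] assms(3) by simp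
  qed
  moreover have "finite ((+) x ` H)" "finite ((+) y ` H)" using assms finite_subset by blast+
  ultimately have "card ((+) x ` H \<union> (+) y ` H) = 2 * card H"
    by (simp add: card_Un_disjoint)
  then show ?thesis using assms by (metis card_mono Un_least)
qed

section \<open>Families of nearly equal translates\<close>

text \<open>The alternative to the conclusion is a sunflower, all of whose pairwise intersections
  coincide; the covering hypothesis excludes it.\<close>

lemma punctured_family:
  fixes M :: "'i \<Rightarrow> 'b set"
  assumes fin: "\<And>t. t \<in> T \<Longrightarrow> finite (M t)"
    and crd: "\<And>t. t \<in> T \<Longrightarrow> card (M t) = Suc n"
    and int: "\<And>t u. t \<in> T \<Longrightarrow> u \<in> T \<Longrightarrow> t \<noteq> u \<Longrightarrow> card (M t \<inter> M u) = n"
    and cov: "\<And>t. t \<in> T \<Longrightarrow> M t \<subseteq> (\<Union>u\<in>T - {t}. M u)"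
    and ne: "T \<noteq> {}"
  obtains J j where "finite J" "card J = Suc (Suc n)"
    "\<And>t. t \<in> T \<Longrightarrow> j t \<in> J \<and> M t = J - {j t}"
proof -
  obtain t0 where t0: "t0 \<in> T" using ne by blast
  define N where "N = M t0"
  have N: "finite N" "card N = Suc n" using fin crd t0 by (auto simp: N_def)
  have "\<exists>a b. a \<in> N \<and> b \<notin> N \<and> M u = insert b (N - {a})" if u: "u \<in> T" "u \<noteq> t0" for u
  proof -
    have c: "card (N \<inter> M u) = n" using int[OF t0 u(1)] u N_def by auto
    have "card (N - M u) = 1" "card (M u - N) = 1"
      using c N fin[OF u(1)] crd[OF u(1)] by (auto simp: card_Diff_subset_Int Int_commute)
    then obtain a b where ab: "N - M u = {a}" "M u - N = {b}" by (meson card_1_singletonE)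
    then have "M u = insert b (N - {a})" by blast
    then show ?thesis using ab by blast
  qed
  then obtain a b where ab: "\<And>u. u \<in> T \<Longrightarrow> u \<noteq> t0 \<Longrightarrow>
      a u \<in> N \<and> b u \<notin> N \<and> M u = insert (b u) (N - {a u})"
    by metis
  have b_eq: "b u = b v" if h: "u \<in> T" "u \<noteq> t0" "v \<in> T" "v \<noteq> t0" "a u \<noteq> a v" for u v
  proof (rule ccontr)
    assume "b u \<noteq> b v"
    \<comment> \<open>With different new points, the intersection lacks both removed points and
      gains nothing.\<close>
    then have "M u \<inter> M v = N - {a u, a v}" using ab[OF h(1,2)] ab[OF h(3,4)] by auto
    moreover have "card (N - {a u, a v}) = Suc n - 2"
      using N ab[OF h(1,2)] ab[OF h(3,4)] h(5) by (simp add: card_Diff_subset)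
    \<comment> \<open>Truncated subtraction makes \<open>Suc n - 2 = n\<close> when
      \<open>n = 0\<close>; two distinct points of \<open>N\<close> exclude this.\<close>
    moreover have "Suc n \<ge> card {a u, a v}"
      using N ab[OF h(1,2)] ab[OF h(3,4)] by (metis card_mono empty_subsetI insert_subset)
    ultimately show False using int[OF h(1,3)] h(5) by (cases "u = v") auto
  qed
  obtain x where x: "x \<in> N" using N by fastforce
  obtain u where u: "u \<in> T" "u \<noteq> t0" using cov[OF t0] x N_def by auto
  \<comment> \<open>Some set covers the point that \<open>M u\<close> lacks, so two different
    removed points occur. Every \<open>a w\<close> differs from one of them, hence all the
    \<open>b w\<close> agree.\<close>
  obtain v where v: "v \<in> T" "v \<noteq> t0" "a v \<noteq> a u"
  proof -
    have "a u \<in> (\<Union>u\<in>T - {t0}. M u)" using cov[OF t0] ab[OF u] N_def by auto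
    then obtain v where v: "v \<in> T" "v \<noteq> t0" "a u \<in> M v" by blast
    have "a v \<noteq> a u" using v(3) ab[OF v(1,2)] ab[OF u] by auto
    show thesis by (rule that) fact+
  qed
  have buv: "b v = b u" using b_eq u v by metis
  have all_b: "b w = b u" if w: "w \<in> T" "w \<noteq> t0" for w
    using b_eq[OF w u] b_eq[OF w v(1,2)] buv v(3) by metis
  define J where "J = insert (b u) N"
  define j where "j w = (if w = t0 then b u else a w)" for w
  have bu: "b u \<notin> N" using ab[OF u] by blast
  have "j w \<in> J \<and> M w = J - {j w}" if w: "w \<in> T" for w
  proof (cases "w = t0")
    case True
    then show ?thesis using bu by (simp add: j_def J_def N_def)
  next
    case False
    then show ?thesis using ab[OF w False] all_b[OF w False] bu by (auto simp: j_def J_def)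
  qed
  moreover have "finite J" "card J = Suc (Suc n)" using N bu by (auto simp: J_def)
  ultimately show thesis using that by blast
qed

text \<open>Passing from \<open>J + t + v\<close> to \<open>J + u + u\<close> by exchanging one summand at a time,
  in either order, gives an identity between sums of three point masses.\<close>

lemma punctured_translates_agree:
  fixes J K :: "'a::ab_group_add set"
  assumes tr: "\<And>t. t \<in> T \<Longrightarrow> (+) t ` J = insert (j t + t) K \<and> j t + t \<notin> K"
    and inj: "inj_on j T" and mem: "t \<in> T" "u \<in> T" "v \<in> T" and dist: "t \<noteq> u" "t \<noteq> v" "u \<noteq> v"
  shows "j u + u = j v + v"
proof -
  define f where "f x = (of_bool (x \<in> J) :: int)" for x
  define g where "g x = (of_bool (x \<in> K) :: int)" for x
  have f: "f (x - s) = g x + of_bool (x = j s + s)" if s: "s \<in> T" for x s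
  proof -
    have "x - s \<in> J \<longleftrightarrow> x \<in> insert (j s + s) K"
      using tr[OF s] translate_minus_mem[of x s J] by simp
    then show ?thesis using tr[OF s] by (auto simp: f_def g_def)
  qed
  have ff: "f (x - r) - f (x - s) = of_bool (x = j r + r) - of_bool (x = j s + s)"
    if rs: "r \<in> T" "s \<in> T" for x r s
    unfolding f[OF rs(1)] f[OF rs(2)] by simp
  \<comment> \<open>This choice puts \<open>x - t\<close> at the point mass \<open>j u + u\<close>.
    Distinctness and injectivity kill two of the three masses on the other side, so the third one,
    at \<open>j v + v\<close>, must also be hit by \<open>x - t\<close>.\<close>
  define x where "x = j u + u + t"
  have e: "x - v - t = x - t - v" "x - v - u = x - u - v" "x - t - u = x - u - t"
    by (simp_all add: algebra_simps)
  have n1: "x - v \<noteq> j u + u" using dist by (simp add: x_def algebra_simps)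
  have n2: "x - u \<noteq> j t + t"
  proof
    assume "x - u = j t + t"
    then have "j u = j t" by (simp add: x_def algebra_simps)
    then show False using inj_onD[OF inj _ mem(2,1)] dist by blast
  qed
  have p: "x - t = j u + u" by (simp add: x_def)
  have "of_bool (x - t = j v + v) =
      1 + (of_bool (x - v = j t + t) :: int) + of_bool (x - u = j v + v)"
    using ff[OF mem(1,2), of "x - v"] ff[OF mem(3,2), of "x - u"]
      ff[OF mem(3,2), of "x - t"] ff[OF mem(1,2), of "x - u"] n1 n2 p
    unfolding e by simp
  then have "x - t = j v + v" by (auto simp: of_bool_def split: if_splits)
  then show ?thesis using p by simp
qed

text \<open>\<open>H\<close> is the stabilizer of \<open>F\<close>. It contains all differences of
  elements of \<open>T\<close>, so it has at least \<open>card T\<close> elements; as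
  \<open>F\<close> is a union of cosets of \<open>H\<close>, its size leaves room for only
  one.\<close>

lemma translates_equal_coset:
  fixes F T :: "'a::ab_group_add set"
  assumes F: "finite F" "F \<noteq> {}"
    and eq: "\<And>t u. t \<in> T \<Longrightarrow> u \<in> T \<Longrightarrow> (+) t ` F = (+) u ` F"
    and small: "card F < 2 * card T"
  obtains H where "is_subgroup H" "finite H" "card H = card F"
    "\<And>t u. t \<in> T \<Longrightarrow> u \<in> T \<Longrightarrow> t - u \<in> H" "\<And>f. f \<in> F \<Longrightarrow> F = (+) f ` H"
proof -
  define H where "H = {x. (+) x ` F = F}"
  have comp: "(+) (x + y) ` F = (+) x ` ((+) y ` F)" for x y
    by (auto simp: image_image add.assoc)
  have H: "is_subgroup H"
    unfolding is_subgroup_def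
  proof (intro conjI ballI)
    show "0 \<in> H" by (simp add: H_def)
    show "x + y \<in> H" if "x \<in> H" "y \<in> H" for x y using that comp by (simp add: H_def)
    show "- x \<in> H" if "x \<in> H" for x
      using that comp[of "- x" x] by (simp add: H_def)
  qed
  have HF: "(+) f ` H \<subseteq> F" if "f \<in> F" for f
    using that by (auto simp: H_def add.commute)
  have finH: "finite H"
  proof -
    obtain f where "f \<in> F" using F by blast
    then have "finite ((+) f ` H)" using HF F finite_subset by blast
    then show ?thesis by (simp add: finite_image_iff)
  qed
  have diff: "t - u \<in> H" if h: "t \<in> T" "u \<in> T" for t u
  proof -
    have "(+) (t - u) ` F = (+) (- u) ` ((+) t ` F)" using comp[of "- u" t] by simp
    also have "\<dots> = (+) (- u) ` ((+) u ` F)" using eq[OF h] by simp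
    also have "\<dots> = F" using comp[of "- u" u] by simp
    finally show ?thesis by (simp add: H_def)
  qed
  have "T \<noteq> {}" using small by auto
  then obtain u where u: "u \<in> T" by blast
  have "T \<subseteq> (+) u ` H" using diff[OF _ u] by (auto simp: translate_minus_mem)
  then have "card T \<le> card H" using finH by (metis card_translate card_mono finite_imageI)
  then have lt: "card F < 2 * card H" using small by simp
  have coset: "F = (+) f ` H" if f: "f \<in> F" for f
  proof (rule ccontr)
    assume "F \<noteq> (+) f ` H"
    then obtain e where e: "e \<in> F" "e \<notin> (+) f ` H" using HF[OF f] by blast
    have "2 * card H \<le> card F"
      by (rule two_cosets_card[OF H F(1), of e f]) (use e HF f in \<open>auto simp: translate_minus_mem\<close>)
    then show False using lt by simp
  qed
  obtain f where "f \<in> F" using F by blast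
  then have "card H = card F" using coset by (metis card_translate)
  then show thesis using that H finH diff coset by blast
qed

text \<open>If \<open>m\<close> is a sum of \<open>k - 3\<close> terms, no zero-sum pair or triple may be added to it.
  Since \<open>k\<close> is small, this forces three involutions among the unused elements.\<close>

lemma wsums_group_minus_two:
  fixes L :: "'a::ab_group_add set"
  assumes L: "is_subgroup L" "finite L" and T: "T = L - {0, h}"
    and k: "2 * k \<le> card T + 2"
    and B: "B \<subseteq> T" "card B + 3 = k" "\<Sum>B = m"
  shows "m \<in> wsums T k"
proof (rule ccontr)
  assume m: "m \<notin> wsums T k"
  have finT: "finite T" using L T by simp
  have finB: "finite B" using B finT finite_subset by blast
  define C where "C = T - B"
  have finC: "finite C" using finT C_def by simp
  have cardC: "card C + card B = card T"
    using B finT finB card_mono[OF finT B(1)] by (simp add: C_def card_Diff_subset)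
  have no: "\<Sum>D \<noteq> m" if "D \<subseteq> T" "card D \<le> k" "k \<le> card D + 2" for D
    using wsumsI[OF that] m by metis
  define I where "I = {a \<in> C. - a = a}"
  have pair: "- a = a" if a: "a \<in> C" "- a \<in> C" for a
  proof (rule ccontr)
    assume ne: "- a \<noteq> a"
    have "B \<inter> {a, - a} = {}" using a by (auto simp: C_def)
    then have "\<Sum>(B \<union> {a, - a}) = m" "card (B \<union> {a, - a}) = card B + 2"
      using ne finB B(3) by (simp_all add: sum.union_disjoint card_Un_disjoint)
    then show False using no[of "B \<union> {a, - a}"] B a by (auto simp: C_def)
  qed
  have "uminus ` (C - I) \<subseteq> insert h B"
  proof clarify
    fix a assume a: "a \<in> C" "a \<notin> I" "- a \<notin> B"
    have "- a \<in> L" "- a \<noteq> 0" using a L T by (auto simp: C_def is_subgroup_def)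
    moreover have "- a \<notin> C" using a pair by (auto simp: I_def)
    ultimately show "- a = h" using a T by (auto simp: C_def)
  qed
  then have "card (uminus ` (C - I)) \<le> card (insert h B)" using finB by (intro card_mono) auto
  moreover have "card (uminus ` (C - I)) = card (C - I)" by (rule card_image) simp
  moreover have "card (C - I) = card C - card I"
    using finC by (intro card_Diff_subset) (auto simp: I_def)
  moreover have "card (insert h B) \<le> card B + 1" using finB by (simp add: card_insert_if)
  \<comment> \<open>\<open>card I\<close> is at least \<open>card T - 2 * card B - 1\<close>, and
    \<open>card B = k - 3\<close> with \<open>2 * k \<le> card T + 2\<close> makes this at least
    \<open>3\<close>.\<close>
  ultimately have "3 \<le> card I" using cardC k B(2) by linarith
  then obtain I3 where "I3 \<subseteq> I" "card I3 = 3" by (meson obtain_subset_with_card_n)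
  then obtain p q r where pqr: "p \<in> I" "q \<in> I" "r \<in> I" "p \<noteq> q" "p \<noteq> r" "q \<noteq> r"
    by (auto simp: card_3_iff)
  have invol: "x + x = 0" if "x \<in> I" for x
    using that by (simp add: I_def eq_neg_iff_add_eq_0[symmetric])
  have IT: "x \<in> C" "x \<in> T" "x \<in> L" "x \<noteq> 0" "x \<notin> B" if "x \<in> I" for x
    using that T by (auto simp: I_def C_def)
  \<comment> \<open>Otherwise \<open>x + y\<close> is in \<open>T\<close>. If \<open>B\<close> uses
    it, replacing it by \<open>x\<close> and \<open>y\<close> keeps the sum and gives
    \<open>k - 2\<close> terms; if not, adjoining the zero-sum triple \<open>x\<close>,
    \<open>y\<close>, \<open>x + y\<close> gives \<open>k\<close> terms.\<close>
  have sum_h: "x + y = h" if xy: "x \<in> I" "y \<in> I" "x \<noteq> y" for x y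
  proof (rule ccontr)
    assume nh: "x + y \<noteq> h"
    have n0: "x + y \<noteq> 0" using xy(3) invol[OF xy(1)] by (metis add_left_cancel)
    have "x + y \<in> L" using L IT xy by (simp add: is_subgroup_def)
    then have inT: "x + y \<in> T" using nh n0 T by simp
    show False
    proof (cases "x + y \<in> B")
      case True
      let ?D = "(B - {x + y}) \<union> {x, y}"
      have disj: "(B - {x + y}) \<inter> {x, y} = {}" using IT xy by auto
      have "\<Sum>?D = \<Sum>(B - {x + y}) + (x + y)"
        using sum.union_disjoint[OF _ _ disj, of "\<lambda>x. x"] finB xy(3) by simp
      also have "\<dots> = m" using finB True B(3) by (simp add: sum_diff1)
      finally have s: "\<Sum>?D = m" .
      have "card ?D = card (B - {x + y}) + 2"
        using card_Un_disjoint[OF _ _ disj] finB xy(3) by simp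
      then have c: "card ?D = card B + 1" using card_Suc_Diff1[OF finB True] by simp
      have "?D \<subseteq> T" using B xy IT by blast
      then show False using no[of ?D] s c B(2) by simp
    next
      case False
      let ?D = "B \<union> {x, y, x + y}"
      have d: "x + y \<noteq> x" "x + y \<noteq> y" using IT xy by auto
      have disj: "B \<inter> {x, y, x + y} = {}" using IT xy False by auto
      have "\<Sum>?D = m + (x + (y + (x + y)))"
        using sum.union_disjoint[OF finB _ disj, of "\<lambda>x. x"] xy(3) d B(3) by simp
      moreover have "card ?D = card B + 3"
        using card_Un_disjoint[OF finB _ disj] xy(3) d by simp
      moreover have "x + (y + (x + y)) = (x + x) + (y + y)" by (simp add: algebra_simps)
      ultimately have "\<Sum>?D = m" "card ?D = card B + 3" using invol xy by auto
      moreover have "?D \<subseteq> T" using B xy IT inT by blast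
      ultimately show False using no[of ?D] B(2) by simp
    qed
  qed
  have "p + q = p + r" using sum_h pqr by metis
  then show False using pqr by simp
qed

section \<open>The inductive bound\<close>

text \<open>For \<open>T = {d, - d}\<close> the sequence is the progression \<open>- d, 0, 0, d\<close>.\<close>

definition wsums_bound :: "'a::ab_group_add set \<Rightarrow> nat \<Rightarrow> bool" where
  "wsums_bound T k \<longleftrightarrow> card T < card (wsums T k) \<and>
    (card (wsums T k) = Suc (card T) \<longrightarrow>
      is_subgroup (insert 0 T) \<or> (\<exists>d. d \<noteq> - d \<and> T = {d, - d}))"

lemma wsums_eq_subgroup:
  assumes "is_subgroup (insert 0 T)" "finite T" "0 \<notin> T"
    and "j = 1 \<or> wsums_bound T j"
  shows "wsums T j = insert 0 T"
  using assms(4)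
proof
  assume "j = 1"
  then show ?thesis
    using insert_zero_subset_wsums[of j T] wsums_subset_subgroup[OF assms(1), of T j] by blast
next
  assume "wsums_bound T j"
  then have "card (insert 0 T) \<le> card (wsums T j)" using assms by (simp add: wsums_bound_def)
  moreover have "wsums T j \<subseteq> insert 0 T" using wsums_subset_subgroup[OF assms(1)] by blast
  ultimately show ?thesis using assms(2) by (intro card_seteq) auto
qed

text \<open>In case of equality the sums are exactly \<open>insert 0 T\<close>, which is then closed
  under sums of distinct elements. Allowing \<open>k\<close> up to \<open>4\<close> serves the
  exceptional case \<open>k = 3\<close>, \<open>card T = 4\<close> besides
  \<open>k = 2\<close>.\<close>

lemma wsums_bound_two:
  fixes T :: "'a::ab_group_add set"
  assumes T: "finite T" "0 \<notin> T" "2 \<le> card T"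
    and sub: "insert 0 T \<subseteq> wsums T k" and k: "2 \<le> k" "k \<le> 4"
  shows "wsums_bound T k"
proof -
  have le: "card (insert 0 T) \<le> card (wsums T k)" by (rule card_mono) (use T sub in auto)
  have "is_subgroup (insert 0 T) \<or> (\<exists>d. d \<noteq> - d \<and> T = {d, - d})"
    if eq: "card (wsums T k) = Suc (card T)"
  proof -
    have W: "wsums T k = insert 0 T"
      using T sub eq by (intro card_subset_eq[symmetric]) auto
    have cl: "x + y \<in> insert 0 T"
      if xy: "x \<in> insert 0 T" "y \<in> insert 0 T" "x \<noteq> y" for x y
    proof (cases "x = 0 \<or> y = 0")
      case True
      then show ?thesis using xy by auto
    next
      case False
      then have "x + y \<in> wsums T k" using xy k by (intro wsums_pair) auto
      then show ?thesis using W by simp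
    qed
    consider "is_subgroup (insert 0 T)"
      | x where "x \<in> insert 0 T" "x + x \<notin> insert 0 T" "insert 0 T \<subseteq> {0, x, - x}"
      using closed_under_distinct_sums[OF _ _ cl] T by blast
    then show ?thesis
    proof cases
      case 2
      then have "T \<subseteq> {x, - x}" using T by auto
      moreover have "card {x, - x} \<le> 2" by (simp add: card_insert_if)
      ultimately have "T = {x, - x}" using T by (intro card_seteq) auto
      moreover from this have "x \<noteq> - x" using T by auto
      ultimately show ?thesis by blast
    qed auto
  qed
  then show ?thesis using le T by (simp add: wsums_bound_def)
qed

section \<open>The extremal case with at least three summands\<close>

locale wsums_extremal =
  fixes T :: "'a::ab_group_add set" and k :: nat
  assumes finT [simp]: "finite T" and zero: "0 \<notin> T"
    and k3: "3 \<le> k" and k_le: "2 * k \<le> card T + 2"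
    and IH: "\<And>(U :: 'a set) j. finite U \<Longrightarrow> card U < card T \<Longrightarrow> 0 \<notin> U \<Longrightarrow> 2 \<le> j \<Longrightarrow> j \<le> card U \<Longrightarrow>
      wsums_bound U j"
    and extremal: "card (wsums T k) \<le> Suc (card T)"
begin

lemma card_T: "4 \<le> card T" "k < card T"
  using k3 k_le by auto

lemma bound_remove1:
  assumes "t \<in> T" "2 \<le> j" "j < card T"
  shows "wsums_bound (T - {t}) j"
  by (rule IH) (use assms zero card_T in auto)

lemma bound_remove2:
  assumes "t \<in> T" "u \<in> T" "t \<noteq> u" "2 \<le> j" "j + 1 < card T"
  shows "wsums_bound (T - {t} - {u}) j"
  by (rule IH) (use assms zero card_T in auto)

lemma add_subset: "t \<in> T \<Longrightarrow> (+) t ` wsums (T - {t}) (k - 1) \<subseteq> wsums T k"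
  using wsums_add[of T t _ k] k3 by auto

text \<open>A smaller value would be \<open>card T\<close>, and the induction hypothesis would make
  \<open>insert 0 (T - {t})\<close> a subgroup of that order. It and its translate by
  \<open>t\<close> would both lie in \<open>wsums T k\<close>, which is too small. The upper bound
  comes from \<open>add_subset\<close>.\<close>

lemma card_wsums_remove1:
  assumes t: "t \<in> T"
  shows "card (wsums (T - {t}) (k - 1)) = Suc (card T)"
proof -
  let ?U = "T - {t}"
  have cU: "card ?U = card T - 1" using t by simp
  have b: "wsums_bound ?U (k - 1)" "wsums_bound ?U k"
    using bound_remove1[OF t] k3 card_T by auto
  have "card (wsums ?U (k - 1)) \<noteq> card T"
  proof
    assume "card (wsums ?U (k - 1)) = card T"
    then have "card (wsums ?U (k - 1)) = Suc (card ?U)" using cU card_T by simp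
    moreover have "\<nexists>d. d \<noteq> - d \<and> ?U = {d, - d}"
    proof clarify
      fix d :: 'a assume "d \<noteq> - d" "?U = {d, - d}"
      then have "card ?U = 2" by simp
      then show False using cU card_T by simp
    qed
    ultimately have sg: "is_subgroup (insert 0 ?U)" using b(1) by (auto simp: wsums_bound_def)
    have W: "wsums ?U (k - 1) = insert 0 ?U" "wsums ?U k = insert 0 ?U"
      using wsums_eq_subgroup[OF sg] b zero by auto
    have "2 * card (insert 0 ?U) \<le> card (wsums T k)"
    proof (rule two_cosets_card[OF sg, of _ t 0])
      show "t - 0 \<notin> insert 0 ?U" using t zero by auto
      show "(+) t ` insert 0 ?U \<subseteq> wsums T k" using add_subset[OF t] W by simp
      show "(+) 0 ` insert 0 ?U \<subseteq> wsums T k" using wsums_mono[of ?U T k] W by auto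
    qed simp
    then show False using extremal cU card_T zero by simp
  qed
  moreover have "card T \<le> card (wsums ?U (k - 1))"
    using b(1) cU card_T unfolding wsums_bound_def by linarith
  moreover have "card (wsums ?U (k - 1)) \<le> card (wsums T k)"
    using card_mono[OF _ add_subset[OF t]] by simp
  ultimately show ?thesis using extremal by simp
qed

lemma card_wsums: "card (wsums T k) = Suc (card T)"
proof -
  obtain t where t: "t \<in> T" using card_T by fastforce
  show ?thesis
    using card_wsums_remove1[OF t] card_mono[OF _ add_subset[OF t]] extremal by simp
qed

lemma add_wsums_remove1: "t \<in> T \<Longrightarrow> (+) t ` wsums (T - {t}) (k - 1) = wsums T k"
  using card_subset_eq[OF _ add_subset] card_wsums card_wsums_remove1 by simp

lemma wsums_remove2_subset:
  "wsums (T - {t} - {u}) j \<subseteq> wsums (T - {t}) j \<inter> wsums (T - {u}) j"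
  by (intro Int_greatest wsums_mono) auto

text \<open>A smaller value typically makes \<open>insert 0 (T - {t} - {u})\<close> a subgroup whose
  translates by \<open>t\<close> and \<open>t + u\<close> both lie in \<open>wsums T k\<close>, too
  many elements when \<open>4 \<le> card T\<close>.\<close>

lemma card_wsums_remove2:
  assumes tu: "t \<in> T" "u \<in> T" "t \<noteq> u" and nsg: "\<not> is_subgroup (insert 0 T)"
  shows "card T \<le> card (wsums (T - {t} - {u}) (k - 1))"
proof (rule ccontr)
  let ?U = "T - {t} - {u}"
  assume "\<not> card T \<le> card (wsums ?U (k - 1))"
  moreover have cU: "card ?U + 2 = card T" using tu card_T by simp
  moreover have b: "wsums_bound ?U (k - 1)"
    using bound_remove2[OF tu] k3 card_T by simp
  ultimately have "card (wsums ?U (k - 1)) = Suc (card ?U)" by (simp add: wsums_bound_def)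
  then consider (sg) "is_subgroup (insert 0 ?U)" | (pair) d where "d \<noteq> - d" "?U = {d, - d}"
    using b by (auto simp: wsums_bound_def)
  then show False
  proof cases
    case sg
    \<comment> \<open>The induction hypothesis starts at index \<open>2\<close>, so
      \<open>k = 3\<close> needs the separate alternative \<open>k - 2 = 1\<close>.\<close>
    have b2: "k - 2 = 1 \<or> wsums_bound ?U (k - 2)"
      using bound_remove2[OF tu, of "k - 2"] k3 card_T by (cases "k = 3") auto
    have W: "wsums ?U (k - 1) = insert 0 ?U" "wsums ?U (k - 2) = insert 0 ?U"
      using wsums_eq_subgroup[OF sg] b b2 zero by auto
    have "2 * card (insert 0 ?U) \<le> card (wsums T k)"
    proof (rule two_cosets_card[OF sg, of _ "t + u" t])
      show "t + u - t \<notin> insert 0 ?U" using tu zero by auto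
      have "wsums ?U (k - 1) \<subseteq> wsums (T - {t}) (k - 1)" by (rule wsums_mono) auto
      then show "(+) t ` insert 0 ?U \<subseteq> wsums T k"
        using add_subset[OF tu(1)] unfolding W by blast
      have "u + x \<in> wsums (T - {t}) (k - 1)" if x: "x \<in> insert 0 ?U" for x
      proof (rule wsums_add)
        have "k - 1 - 1 = k - 2" by simp
        then show "x \<in> wsums ?U (k - 1 - 1)" using W(2) x by (simp only:)
      qed (use tu k3 in auto)
      then show "(+) (t + u) ` insert 0 ?U \<subseteq> wsums T k"
        using add_subset[OF tu(1)] unfolding image_subset_iff add.assoc by blast
    qed simp
    then show False using extremal cU card_T zero by simp
  next
    case pair
    have "card ?U = 2" using pair by simp
    \<comment> \<open>The progression case survives only here. Now \<open>0\<close> is the sum of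
      the pair \<open>d\<close>, \<open>- d\<close>, so all of \<open>insert 0 T\<close> consists of
      sums and the argument for two summands applies to \<open>T\<close> itself.\<close>
    then have c: "card T = 4" "k = 3" using cU k3 k_le by auto
    have "insert 0 T \<subseteq> wsums T k"
    proof clarify
      fix x assume x: "x \<in> insert 0 T"
      show "x \<in> wsums T k"
      proof (cases "x = 0")
        case True
        have "d + (- d) \<in> wsums T k" by (rule wsums_pair) (use pair c in auto)
        then show ?thesis using True by simp
      next
        case False
        then show ?thesis using wsumsI[of "{x}" T k] x c by simp
      qed
    qed
    then have "wsums_bound T k" using wsums_bound_two[of T k] zero c by simp
    then obtain e where "e \<noteq> - e" "T = {e, - e}" using nsg card_wsums by (auto simp: wsums_bound_def)
    then have "card T = 2" by simp
    then show False using c by simp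
  qed
qed

text \<open>Since \<open>k < card T\<close>, some two sums differ by a single element of \<open>T\<close>.\<close>

lemma subset_of_coset:
  assumes H: "is_subgroup H" and diff: "\<And>t u. t \<in> T \<Longrightarrow> u \<in> T \<Longrightarrow> t - u \<in> H"
    and K: "\<And>x y. x \<in> wsums T k \<Longrightarrow> y \<in> wsums T k \<Longrightarrow> x - y \<in> H"
  shows "T \<subseteq> H"
proof -
  obtain B where B: "B \<subseteq> T" "card B = k - 1"
    using obtain_subset_with_card_n[of "k - 1" T] card_T(2)
    by (metis diff_le_self le_trans nat_less_le)
  have finB: "finite B" using B(1) finT finite_subset by blast
  have "B \<noteq> T" using B card_T by auto
  then obtain t where t: "t \<in> T" "t \<notin> B" using B by blast
  have "\<Sum>B \<in> wsums T k" "\<Sum>(insert t B) \<in> wsums T k"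
    by (rule wsumsI; use B t finB k3 in simp)+
  then have "\<Sum>(insert t B) - \<Sum>B \<in> H" using K by blast
  then have tH: "t \<in> H" using t finB by simp
  show ?thesis
  proof
    fix u assume "u \<in> T"
    then have "u - t + t \<in> H" using diff t tH H unfolding is_subgroup_def by blast
    then show "u \<in> H" by simp
  qed
qed

lemma wsums_remove1_eq: "t \<in> T \<Longrightarrow> wsums (T - {t}) (k - 1) = (+) (- t) ` wsums T k"
  by (simp add: add_wsums_remove1[symmetric] image_image del: One_nat_def)

lemma card_Int_remove:
  assumes "t \<in> T" "u \<in> T" "t \<noteq> u" "\<not> is_subgroup (insert 0 T)"
  shows "card T \<le> card (wsums (T - {t}) (k - 1) \<inter> wsums (T - {u}) (k - 1))"
  using card_wsums_remove2[OF assms] wsums_remove2_subset[of t u "k - 1"]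
  by (meson card_mono finT finite_Diff finite_Int finite_wsums le_trans)

text \<open>Equal translates make \<open>wsums T k\<close> a coset of a group of order
  \<open>Suc (card T)\<close>. By \<open>subset_of_coset\<close> this group contains
  \<open>T\<close>, so it is \<open>insert 0 T\<close>.\<close>

lemma subgroup_if_translates_equal:
  assumes "\<And>t u. t \<in> T \<Longrightarrow> u \<in> T \<Longrightarrow> (+) t ` wsums T k = (+) u ` wsums T k"
  shows "is_subgroup (insert 0 T)"
proof -
  have "wsums T k \<noteq> {}" using card_wsums by auto
  then obtain H where H: "is_subgroup H" "finite H" "card H = card (wsums T k)"
    "\<And>t u. t \<in> T \<Longrightarrow> u \<in> T \<Longrightarrow> t - u \<in> H" "\<And>f. f \<in> wsums T k \<Longrightarrow> wsums T k = (+) f ` H"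
    by (rule translates_equal_coset[OF finite_wsums[OF finT] _ assms])
      (use card_wsums card_T in auto)
  have "x - y \<in> H" if xy: "x \<in> wsums T k" "y \<in> wsums T k" for x y
    using H(5)[OF xy(2)] xy(1) translate_minus_mem[of x y H] by simp
  then have "T \<subseteq> H" using subset_of_coset[OF H(1,4)] by blast
  then have "insert 0 T \<subseteq> H" using H(1) by (simp add: is_subgroup_def)
  then have "insert 0 T = H"
    by (rule card_subset_eq[OF H(2)]) (use H(3) card_wsums zero in simp)
  then show ?thesis using H(1) by simp
qed

text \<open>If two of the sets coincide for \<open>t \<noteq> u\<close>, then
  \<open>wsums T k\<close> has the period \<open>t - u\<close>, and so have all its translates
  \<open>?M v\<close>. A difference \<open>?M v - ?M w\<close> is then periodic too, but has at most
  one element; hence it is empty and all the \<open>?M v\<close> coincide.\<close>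

lemma remove1_inj:
  assumes nsg: "\<not> is_subgroup (insert 0 T)"
    and tu: "t \<in> T" "u \<in> T" "wsums (T - {t}) (k - 1) = wsums (T - {u}) (k - 1)"
  shows "t = u"
proof (rule ccontr)
  assume ne: "t \<noteq> u"
  let ?M = "\<lambda>t. wsums (T - {t}) (k - 1)"
  have per: "x + (t - u) \<in> wsums T k \<longleftrightarrow> x \<in> wsums T k" for x
  proof -
    have "x \<in> wsums T k \<longleftrightarrow> x - u \<in> ?M u"
      using add_wsums_remove1[OF tu(2)] translate_minus_mem by metis
    moreover have "x + (t - u) \<in> wsums T k \<longleftrightarrow> x + (t - u) - t \<in> ?M t"
      using add_wsums_remove1[OF tu(1)] translate_minus_mem by metis
    moreover have "x + (t - u) - t = x - u" by simp
    ultimately show ?thesis using tu(3) by simp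
  qed
  have Mmem: "x \<in> ?M v \<longleftrightarrow> x + v \<in> wsums T k" if v: "v \<in> T" for x v
    using wsums_remove1_eq[OF v] translate_minus_mem[of x "- v" "wsums T k"] by simp
  have Mper: "x + (t - u) \<in> ?M v \<longleftrightarrow> x \<in> ?M v" if v: "v \<in> T" for x v
  proof -
    have "x + (t - u) + v = x + v + (t - u)" by (simp add: algebra_simps)
    then show ?thesis unfolding Mmem[OF v] using per[of "x + v"] by (simp only:)
  qed
  have sub: "?M v \<subseteq> ?M w" if vw: "v \<in> T" "w \<in> T" for v w
  proof (cases "v = w")
    case False
    show ?thesis
    proof
      fix x assume x: "x \<in> ?M v"
      show "x \<in> ?M w"
      proof (rule ccontr)
        assume nx: "x \<notin> ?M w"
        have "{x, x + (t - u)} \<subseteq> ?M v - ?M w" using x nx Mper vw by blast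
        then have "card {x, x + (t - u)} \<le> card (?M v - ?M w)" by (intro card_mono) simp_all
        moreover have "card (?M v - ?M w) = card (?M v) - card (?M v \<inter> ?M w)"
          by (rule card_Diff_subset_Int) simp
        moreover have "card {x, x + (t - u)} = 2" using ne by simp
        ultimately show False
          using card_Int_remove[OF vw False nsg] card_wsums_remove1[OF vw(1)] by linarith
      qed
    qed
  qed simp
  have "is_subgroup (insert 0 T)"
  proof (rule subgroup_if_translates_equal)
    fix v w assume vw: "v \<in> T" "w \<in> T"
    have "?M v = ?M w" using sub vw by blast
    then have e: "(+) (- v) ` wsums T k = (+) (- w) ` wsums T k"
      using wsums_remove1_eq vw by metis
    \<comment> \<open>Translating by \<open>v + w\<close> turns the shifts by \<open>- w\<close> and
      \<open>- v\<close> into shifts by \<open>v\<close> and \<open>w\<close>.\<close>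
    have "(+) v ` wsums T k = (+) (v + w) ` ((+) (- w) ` wsums T k)" by (simp add: image_image add.assoc)
    also have "\<dots> = (+) (v + w) ` ((+) (- v) ` wsums T k)" using e by simp
    also have "\<dots> = (+) w ` wsums T k" by (simp add: image_image add.assoc[symmetric])
    finally show "(+) v ` wsums T k = (+) w ` wsums T k" .
  qed
  then show False using nsg by simp
qed

lemma subgroup: "is_subgroup (insert 0 T)"
proof (rule ccontr)
  assume nsg: "\<not> is_subgroup (insert 0 T)"
  let ?M = "\<lambda>t. wsums (T - {t}) (k - 1)"
  let ?X = "\<lambda>t u. wsums (T - {t} - {u}) (k - 1)"
  have Mcard: "card (?M t) = Suc (card T)" if "t \<in> T" for t
    using card_wsums_remove1[OF that] .
  have Icard: "card (?M t \<inter> ?M u) = card T" if tu: "t \<in> T" "u \<in> T" "t \<noteq> u" for t u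
  proof (rule ccontr)
    assume "card (?M t \<inter> ?M u) \<noteq> card T"
    then have c: "Suc (card T) \<le> card (?M t \<inter> ?M u)" using card_Int_remove[OF tu nsg] by linarith
    have "?M t \<inter> ?M u = ?M t" "?M t \<inter> ?M u = ?M u"
      by (rule card_seteq; use c Mcard tu in simp)+
    then have "?M t = ?M u" by simp
    then show False using remove1_inj[OF nsg tu(1,2)] tu(3) by blast
  qed
  have X: "?X t u = ?M t \<inter> ?M u" if tu: "t \<in> T" "u \<in> T" "t \<noteq> u" for t u
    by (rule card_seteq) (use wsums_remove2_subset[of t u "k - 1"] Icard[OF tu]
        card_wsums_remove2[OF tu nsg] in simp_all)
  have cov: "?M t \<subseteq> (\<Union>u\<in>T - {t}. ?M u)" if t: "t \<in> T" for t
  proof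
    fix x assume "x \<in> ?M t"
    then obtain B where B: "B \<subseteq> T - {t}" "card B \<le> k - 1" "k - 1 \<le> card B + 2" "x = \<Sum>B"
      by (rule wsumsE)
    have "card (T - {t}) = card T - 1" using t by simp
    then have "B \<noteq> T - {t}" using B(2) card_T by auto
    then obtain u where u: "u \<in> T" "u \<noteq> t" "u \<notin> B" using B(1) by blast
    have "x \<in> ?M u" unfolding B(4) by (rule wsumsI) (use B u in auto)
    then show "x \<in> (\<Union>u\<in>T - {t}. ?M u)" using u by blast
  qed
  have ne: "T \<noteq> {}" using card_T by auto
  have finM: "finite (?M t)" for t by simp
  obtain J j where J: "finite J" "card J = Suc (Suc (card T))"
    and j: "\<And>t. t \<in> T \<Longrightarrow> j t \<in> J \<and> ?M t = J - {j t}"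
    by (rule punctured_family[of T ?M "card T", OF finM Mcard Icard cov ne]) blast+
  have tr: "(+) t ` J = insert (j t + t) (wsums T k) \<and> j t + t \<notin> wsums T k" if t: "t \<in> T" for t
  proof -
    have "J = insert (j t) (?M t)" using j[OF t] by blast
    then have "(+) t ` J = insert (t + j t) ((+) t ` ?M t)" by (metis image_insert)
    moreover have "j t + t \<notin> (+) t ` ?M t" using j[OF t] by (auto simp: translate_minus_mem)
    ultimately show ?thesis using add_wsums_remove1[OF t] by (simp add: add.commute)
  qed
  have injj: "inj_on j T"
  proof (rule inj_onI)
    fix t u assume tu: "t \<in> T" "u \<in> T" "j t = j u"
    then have "?M t = ?M u" using j by metis
    then show "t = u" using remove1_inj[OF nsg tu(1,2)] by blast
  qed
  \<comment> \<open>The third element \<open>t\<close> needed for the exchange exists because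
    \<open>4 \<le> card T\<close>. The common value is the one point \<open>m\<close> that every
    translate of \<open>J\<close> has beyond \<open>wsums T k\<close>.\<close>
  have z: "j u + u = j v + v" if uv: "u \<in> T" "v \<in> T" for u v
  proof (cases "u = v")
    case False
    have "\<not> T \<subseteq> {u, v}"
    proof
      assume "T \<subseteq> {u, v}"
      then have "card T \<le> card {u, v}" by (intro card_mono) auto
      then show False using card_T False by simp
    qed
    then obtain t where t: "t \<in> T" "t \<noteq> u" "t \<noteq> v" by blast
    show ?thesis by (rule punctured_translates_agree[OF tr injj t(1) uv t(2,3) False])
  qed simp
  have Jeq: "(+) t ` J = (+) u ` J" if tu: "t \<in> T" "u \<in> T" for t u
    using tr[OF tu(1)] tr[OF tu(2)] z[OF tu] by simp
  have "J \<noteq> {}" using J by auto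
  then obtain L where L: "is_subgroup L" "finite L" "card L = card J"
    "\<And>t u. t \<in> T \<Longrightarrow> u \<in> T \<Longrightarrow> t - u \<in> L" "\<And>f. f \<in> J \<Longrightarrow> J = (+) f ` L"
    by (rule translates_equal_coset[OF J(1) _ Jeq]) (use J card_T in auto)
  obtain t where t: "t \<in> T" using ne by blast
  define m where "m = j t + t"
  have KJ: "(+) t ` J = insert m (wsums T k)" "m \<notin> wsums T k" using tr[OF t] m_def by auto
  have KL: "x - y \<in> L" if xy: "x \<in> insert m (wsums T k)" "y \<in> insert m (wsums T k)" for x y
  proof -
    have "x - t \<in> J" "y - t \<in> J" using xy KJ(1) translate_minus_mem by metis+
    then have "x - t - (y - t) \<in> L" using L(5) translate_minus_mem by metis
    then show ?thesis by simp
  qed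
  have TL: "T \<subseteq> L" using subset_of_coset[OF L(1,4)] KL by blast
  \<comment> \<open>\<open>L\<close> has \<open>card T + 2\<close> elements, so exactly one remains
    besides \<open>T\<close> and \<open>0\<close>.\<close>
  have "card (L - insert 0 T) = 1"
    using TL L(1,2,3) J(2) zero by (subst card_Diff_subset) (auto simp: is_subgroup_def)
  then obtain h where h: "L - insert 0 T = {h}" by (meson card_1_singletonE)
  have TLh: "T = L - {0, h}" using h TL zero by blast
  have KinL: "wsums T k \<subseteq> L" using wsums_subset_subgroup[OF L(1) TL] .
  have "m \<in> L"
  proof -
    obtain y where y: "y \<in> wsums T k" using card_wsums by fastforce
    then have "m - y + y \<in> L" using KL[of m y] KinL L(1) unfolding is_subgroup_def by blast
    then show ?thesis by simp
  qed
  then have K: "insert m (wsums T k) = L"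
    using KinL KJ L J card_wsums by (intro card_subset_eq) auto
  obtain u where u: "u \<in> T" "t \<noteq> u"
  proof -
    have "\<not> T \<subseteq> {t}" using card_mono[of "{t}" T] card_T by auto
    then show thesis using that by blast
  qed
  \<comment> \<open>\<open>wsums T k\<close> is \<open>L\<close> without \<open>m\<close>, so it
    contains \<open>m + v\<close> for nonzero \<open>v\<close>; undoing the translation puts
    \<open>m\<close> into every \<open>?M v\<close>.\<close>
  have mM: "m \<in> ?M v" if v: "v \<in> T" for v
  proof -
    have "m + v \<in> L" using \<open>m \<in> L\<close> v TL L(1) by (auto simp: is_subgroup_def)
    moreover have "m + v \<noteq> m" using v zero by auto
    ultimately have "m + v \<in> wsums T k" using K by blast
    then show ?thesis
      using wsums_remove1_eq[OF v] translate_minus_mem[of m "- v" "wsums T k"] by simp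
  qed
  have "m \<in> ?X t u" using mM t u X[OF t u] by blast
  then obtain B where B: "B \<subseteq> T - {t} - {u}" "card B \<le> k - 1" "k - 1 \<le> card B + 2" "m = \<Sum>B"
    by (rule wsumsE)
  have BT: "B \<subseteq> T" using B(1) by blast
  \<comment> \<open>With \<open>k - 2\<close> or \<open>k - 1\<close> terms, \<open>B\<close> would
    also be admissible for \<open>wsums T k\<close>, which omits \<open>m\<close>. Only the smallest
    size allowed in \<open>wsums T (k - 1)\<close> is left.\<close>
  have "card B + 3 = k"
  proof (rule ccontr)
    assume "card B + 3 \<noteq> k"
    then have "m \<in> wsums T k" unfolding B(4) by (intro wsumsI BT) (use B k3 in auto)
    then show False using KJ by blast
  qed
  then have "m \<in> wsums T k"
    using wsums_group_minus_two[OF L(1,2) TLh k_le BT] B(4) by simp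
  then show False using KJ by blast
qed

end

text \<open>The induction on \<open>card T\<close> covers all \<open>k\<close> at once, because
  removing elements of \<open>T\<close> also lowers \<open>k\<close>.\<close>

theorem wsums_bound_general:
  fixes T :: "'a::ab_group_add set"
  assumes "finite T" "0 \<notin> T" "2 \<le> k" "k \<le> card T"
  shows "wsums_bound T k"
  using assms
proof (induction "card T" arbitrary: T k rule: less_induct)
  case less
  have small: "wsums_bound T j" if j: "2 \<le> j" "2 * j \<le> card T + 2" for j
  proof (cases "j = 2")
    case True
    then show ?thesis
      using less.prems insert_zero_subset_wsums[of j T] by (intro wsums_bound_two) auto
  next
    case False
    show ?thesis
    \<comment> \<open>Above \<open>Suc (card T)\<close> there is nothing to prove; the locale treats
      a failure of the bound and the equality case together.\<close>
    proof (cases "card (wsums T j) \<le> Suc (card T)")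
      case True
      interpret wsums_extremal T j
        by unfold_locales (use less j False True in auto)
      show ?thesis using card_wsums subgroup by (simp add: wsums_bound_def)
    qed (simp add: wsums_bound_def)
  qed
  show ?case
  proof (cases "2 * k \<le> card T + 2")
    case True
    then show ?thesis using small less.prems by blast
  next
    case False
    \<comment> \<open>The complementary index is at least \<open>2\<close> because
      \<open>k \<le> card T\<close>.\<close>
    have "wsums_bound T (card T + 2 - k)" by (rule small) (use False less.prems in auto)
    then show ?thesis using card_wsums_dual[of T k] less.prems by (simp add: wsums_bound_def)
  qed
qed

section \<open>Sums of sub-multisets\<close>

lemma ksumsI: "B \<subseteq># A \<Longrightarrow> size B = k \<Longrightarrow> sum_mset B \<in> ksums k A"
  unfolding ksums_def by blast

lemma ksumsE:
  assumes "x \<in> ksums k A"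
  obtains B where "B \<subseteq># A" "size B = k" "x = sum_mset B"
  using assms unfolding ksums_def by blast

lemma finite_ksums [simp]: "finite (ksums k A)"
proof -
  have "ksums k A \<subseteq> (\<lambda>xs. sum_mset (mset xs)) ` {xs. set xs \<subseteq> set_mset A \<and> length xs = k}"
  proof
    fix x assume "x \<in> ksums k A"
    then obtain B where B: "B \<subseteq># A" "size B = k" "x = sum_mset B" by (rule ksumsE)
    obtain xs where xs: "mset xs = B" using ex_mset by blast
    have "set xs \<subseteq> set_mset A" "length xs = k"
      using xs B set_mset_mono[OF B(1)] by (auto simp flip: set_mset_mset size_mset)
    then show "x \<in> (\<lambda>xs. sum_mset (mset xs)) ` {xs. set xs \<subseteq> set_mset A \<and> length xs = k}"
      using xs B(3) by auto
  qed
  then show ?thesis by (rule finite_subset) (simp add: finite_lists_length_eq)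
qed

lemma ex_submultiset_size:
  assumes "n \<le> size A"
  shows "\<exists>C. C \<subseteq># A \<and> size C = n"
proof -
  obtain xs where xs: "mset xs = A" using ex_mset by blast
  have "mset (take n xs) + mset (drop n xs) = A" using xs by (simp flip: mset_append)
  then have "mset (take n xs) \<subseteq># A" using mset_subset_eq_add_left by metis
  moreover have "size (mset (take n xs)) = n" using assms by (simp flip: xs)
  ultimately show ?thesis by blast
qed

text \<open>Fix \<open>k - j\<close> terms outside \<open>A'\<close>, which the last hypothesis
  makes available; adding them translates the shorter sums into the longer ones.\<close>

lemma card_ksums_mono:
  fixes A :: "'a::ab_group_add multiset"
  assumes "A' \<subseteq># A" "j \<le> k" "k + size A' \<le> j + size A"
  shows "card (ksums j A') \<le> card (ksums k A)"
proof -
  have "k - j \<le> size (A - A')" using assms by (simp add: size_Diff_submset)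
  then obtain C where C: "C \<subseteq># A - A'" "size C = k - j" using ex_submultiset_size by blast
  have "(+) (sum_mset C) ` ksums j A' \<subseteq> ksums k A"
  proof clarify
    fix x assume "x \<in> ksums j A'"
    then obtain B where B: "B \<subseteq># A'" "size B = j" "x = sum_mset B" by (rule ksumsE)
    have "C + B \<subseteq># (A - A') + A'" using C(1) B(1) by (rule subset_mset.add_mono)
    then have "C + B \<subseteq># A" using assms(1) by (simp add: subset_mset.diff_add)
    then have "sum_mset (C + B) \<in> ksums k A" by (rule ksumsI) (use B C assms in simp)
    then show "sum_mset C + x \<in> ksums k A" using B(3) by simp
  qed
  then show ?thesis by (metis card_mono card_translate finite_ksums)
qed

lemma sum_const_eq_replicate:
  "finite B \<Longrightarrow> (\<Sum>x\<in>B. a) = sum_mset (replicate_mset (card B) (a::'a::ab_group_add))"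
  by (induction B rule: finite_induct) auto

text \<open>The two zeros become the two copies of \<open>a\<close>: a subset \<open>B\<close> of
  \<open>T\<close> is shifted by \<open>a\<close> and filled up to length \<open>k\<close> with at
  most two copies of \<open>a\<close>.\<close>

lemma wsums_translate_subset_ksums:
  fixes a :: "'a::ab_group_add"
  assumes T: "finite T" "0 \<notin> T"
  shows "(+) (sum_mset (replicate_mset k a)) ` wsums T k
    \<subseteq> ksums k (mset_set ((+) a ` insert 0 T) + {#a#})"
proof clarify
  fix x assume "x \<in> wsums T k"
  then obtain B where B: "B \<subseteq> T" "card B \<le> k" "k \<le> card B + 2" "x = \<Sum>B" by (rule wsumsE)
  have finB: "finite B" using B T finite_subset by blast
  let ?D = "mset_set ((+) a ` B) + replicate_mset (k - card B) a"
  have aT: "a \<notin> (+) a ` T" using T by auto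
  have "mset_set ((+) a ` B) \<subseteq># mset_set ((+) a ` T)"
    using B T by (intro subset_imp_msubset_mset_set) auto
  moreover have "replicate_mset (k - card B) a \<subseteq># {#a, a#}"
    using replicate_mset_msubseteq_iff[of "k - card B" a 2 a] B(3)
    by (simp add: numeral_2_eq_2) linarith
  ultimately have "?D \<subseteq># mset_set ((+) a ` T) + {#a, a#}" by (rule subset_mset.add_mono)
  also have "\<dots> = mset_set ((+) a ` insert 0 T) + {#a#}" using T aT by simp
  finally have sub: "?D \<subseteq># \<dots>" .
  have "sum_mset (mset_set ((+) a ` B)) = (\<Sum>x\<in>B. a + x)"
    using sum_unfold_sum_mset[of "\<lambda>x. x" "(+) a ` B"] by (simp add: sum.reindex)
  also have "\<dots> = sum_mset (replicate_mset (card B) a) + x"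
    using sum_const_eq_replicate[OF finB] B(4) by (simp add: sum.distrib)
  finally have "sum_mset ?D
      = sum_mset (replicate_mset (card B) a + replicate_mset (k - card B) a) + x"
    by (simp add: algebra_simps)
  also have "replicate_mset (card B) a + replicate_mset (k - card B) a = replicate_mset k a"
    using B(2) by (simp add: multiset_eq_iff)
  finally have "sum_mset ?D = sum_mset (replicate_mset k a) + x" .
  moreover have "size ?D = k" using B finB by (simp add: card_image)
  ultimately show "sum_mset (replicate_mset k a) + x
      \<in> ksums k (mset_set ((+) a ` insert 0 T) + {#a#})"
    using ksumsI[OF sub] by metis
qed

lemma ksums_bound_repeated:
  fixes A :: "'a::ab_group_add multiset"
  assumes k: "2 \<le> k" "k + 2 \<le> size A"
    and S: "3 \<le> card (set_mset A)" and a: "2 \<le> count A a"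
  shows "card (set_mset A) \<le> card (ksums k A)"
    and "card (ksums k A) = card (set_mset A) \<Longrightarrow>
      is_subgroup_coset (set_mset A) \<or> (\<exists>d. d \<noteq> - d \<and> set_mset A = {a, a + d, a - d})"
proof -
  let ?S = "set_mset A"
  define T where "T = (+) (- a) ` (?S - {a})"
  have aS: "a \<in> ?S" using a by (metis count_greater_zero_iff less_le_trans zero_less_numeral)
  have finT: "finite T" and zero: "0 \<notin> T" by (auto simp: T_def)
  have "(+) a ` T = ?S - {a}" by (simp add: T_def image_image)
  then have ST: "(+) a ` insert 0 T = ?S" using aS by auto
  have cT: "card ?S = Suc (card T)" using ST finT zero by (metis card_insert_disjoint card_translate)
  let ?A0 = "mset_set ?S + {#a#}"
  have sub: "?A0 \<subseteq># A"
  proof (rule mset_subset_eqI)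
    fix x
    show "count ?A0 x \<le> count A x"
    proof (cases "x = a")
      case True
      then show ?thesis using a aS by simp
    next
      case False
      then show ?thesis by (cases "x \<in># A") (auto simp: Suc_le_eq)
    qed
  qed
  have size0: "size ?A0 = card T + 2" using cT by simp
  have sizeA: "card T + 2 \<le> size A" using size_mset_mono[OF sub] size0 by simp
  \<comment> \<open>Outside \<open>?A0\<close> there are \<open>size A - card T - 2\<close> terms,
    and \<open>k - j\<close> of them get fixed. This \<open>j\<close> is the least one for which
    they suffice and which \<open>wsums_bound_general\<close> admits.\<close>
  define j where "j = max 2 (k + card T + 2 - size A)"
  have j: "2 \<le> j" "j \<le> card T" "j \<le> k" "k + (card T + 2) \<le> j + size A"
    using k S cT sizeA by (auto simp: j_def)
  have b: "wsums_bound T j" by (rule wsums_bound_general) (use finT zero j in auto)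
  have "card (wsums T j) \<le> card (ksums j ?A0)"
    using wsums_translate_subset_ksums[OF finT zero, of j a] unfolding ST
    by (metis card_mono card_translate finite_ksums)
  also have "\<dots> \<le> card (ksums k A)" by (rule card_ksums_mono[OF sub]) (use j size0 in auto)
  finally have le: "card (wsums T j) \<le> card (ksums k A)" .
  show "card ?S \<le> card (ksums k A)" using b le cT by (simp add: wsums_bound_def)
  assume "card (ksums k A) = card ?S"
  then have "card (wsums T j) = Suc (card T)" using b le cT by (simp add: wsums_bound_def)
  then consider "is_subgroup (insert 0 T)" | d where "d \<noteq> - d" "T = {d, - d}"
    using b by (auto simp: wsums_bound_def)
  then show "is_subgroup_coset ?S \<or> (\<exists>d. d \<noteq> - d \<and> ?S = {a, a + d, a - d})"
  proof cases
    case 1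
    then have "is_subgroup_coset ?S" using ST unfolding is_subgroup_coset_def by metis
    then show ?thesis ..
  next
    case 2
    then have "?S = {a, a + d, a - d}" using ST by auto
    then show ?thesis using 2 by blast
  qed
qed

section \<open>Upper bounds in the three equality cases\<close>

lemma ksums_subgroup_coset_card:
  fixes A :: "'a::ab_group_add multiset"
  assumes "is_subgroup_coset (set_mset A)"
  shows "card (ksums k A) \<le> card (set_mset A)"
proof -
  obtain g H where H: "is_subgroup H" "set_mset A = (\<lambda>h. g + h) ` H"
    using assms unfolding is_subgroup_coset_def by blast
  have sum: "sum_mset B - sum_mset (replicate_mset (size B) g) \<in> H" if "set_mset B \<subseteq> set_mset A" for B
    using that
  proof (induction B)
    case empty
    then show ?case using H by (simp add: is_subgroup_def)
  next
    case (add x B)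
    then have "x - g \<in> H" using H(2) translate_minus_mem[of x g H] by simp
    moreover have "sum_mset B - sum_mset (replicate_mset (size B) g) \<in> H" using add by simp
    ultimately have "(x - g) + (sum_mset B - sum_mset (replicate_mset (size B) g)) \<in> H"
      using H(1) by (simp add: is_subgroup_def)
    then show ?case by (simp add: algebra_simps)
  qed
  have "ksums k A \<subseteq> (+) (sum_mset (replicate_mset k g)) ` H"
  proof
    fix x assume "x \<in> ksums k A"
    then obtain B where B: "B \<subseteq># A" "size B = k" "x = sum_mset B" by (rule ksumsE)
    then show "x \<in> (+) (sum_mset (replicate_mset k g)) ` H"
      using sum[OF set_mset_mono[OF B(1)]] by (simp add: translate_minus_mem)
  qed
  moreover have "finite H"
    using H(2) finite_set_mset[of A] by (simp add: finite_image_iff)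
  moreover have "card (set_mset A) = card H" using H(2) card_translate[of g H] by simp
  ultimately show ?thesis by (metis card_mono card_translate finite_imageI)
qed

lemma sum_mset_eq_shift:
  fixes a :: "'a::ab_group_add"
  shows "sum_mset B = sum_mset (replicate_mset (size B) a) + (\<Sum>x\<in>#B. x - a)"
  by (induction B) (auto simp: algebra_simps)

text \<open>Once \<open>a\<close> is subtracted from every term, copies of \<open>a\<close>
  contribute nothing, and all other terms occur at most once, so the set of them determines the
  sum.\<close>

lemma ksums_single_repeated:
  fixes A :: "'a::ab_group_add multiset"
  assumes "mult_support 2 A = {a}"
  shows "ksums k A \<subseteq> (\<lambda>C. sum_mset (replicate_mset k a) + (\<Sum>x\<in>C. x - a)) ` Pow (set_mset A - {a})"
proof
  fix y assume "y \<in> ksums k A"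
  then obtain B where B: "B \<subseteq># A" "size B = k" "y = sum_mset B" by (rule ksumsE)
  define C where "C = set_mset B - {a}"
  have "filter_mset (\<lambda>x. x \<noteq> a) B = mset_set C"
  proof (rule multiset_eqI)
    fix x
    have "count B x \<le> 1" if "x \<noteq> a"
    proof -
      have "x \<notin> mult_support 2 A" using assms that by simp
      then have "count A x < 2" by (cases "x \<in># A") (auto simp: mult_support_def not_in_iff)
      then show ?thesis using mset_subset_eq_count[OF B(1), of x] by simp
    qed
    then show "count (filter_mset (\<lambda>x. x \<noteq> a) B) x = count (mset_set C) x"
      by (cases "x \<in># B"; cases "x = a")
        (auto simp: C_def not_in_iff count_mset_set' le_Suc_eq simp flip: count_greater_zero_iff)
  qed
  moreover have "(\<Sum>x\<in>#B. x - a) = (\<Sum>x\<in>#filter_mset (\<lambda>x. x \<noteq> a) B. x - a)"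
    by (induction B) auto
  ultimately have "y = sum_mset (replicate_mset k a) + (\<Sum>x\<in>C. x - a)"
    using sum_mset_eq_shift[of B a] B by (simp add: sum_unfold_sum_mset)
  moreover have "C \<in> Pow (set_mset A - {a})" using set_mset_mono[OF B(1)] by (auto simp: C_def)
  ultimately show "y \<in> (\<lambda>C. sum_mset (replicate_mset k a) + (\<Sum>x\<in>C. x - a)) ` Pow (set_mset A - {a})"
    by blast
qed

lemma ksums_two_elements_card:
  fixes A :: "'a::ab_group_add multiset"
  assumes "card (set_mset A) = 2" "card (mult_support 2 A) = 1"
  shows "card (ksums k A) \<le> 2"
proof -
  obtain a where a: "mult_support 2 A = {a}" using assms(2) by (rule card_1_singletonE)
  then have "a \<in> set_mset A" by (auto simp: mult_support_def)
  then have "card (set_mset A - {a}) = 1" using assms(1) by simp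
  then have "card (Pow (set_mset A - {a})) = 2" by (simp add: card_Pow)
  then show ?thesis
    using surj_card_le[OF _ ksums_single_repeated[OF a]]
    by (metis finite_Diff finite_Pow_iff finite_set_mset)
qed

text \<open>Relative to the middle term the outer ones are \<open>- d\<close> and \<open>d\<close>;
  choosing both or neither gives the same sum, so four subsets yield three values.\<close>

lemma ksums_three_term_progression_card:
  fixes A :: "'a::ab_group_add multiset"
  assumes "set_mset A = {x, x + d, x + d + d}" "mult_support 2 A = {x + d}"
    and dist: "distinct [x, x + d, x + d + d]"
  shows "card (ksums k A) \<le> 3"
proof -
  let ?c = "sum_mset (replicate_mset k (x + d))"
  have S: "set_mset A - {x + d} = {x, x + d + d}" using assms by auto
  have "ksums k A \<subseteq> {?c, ?c - d, ?c + d}"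
  proof
    fix y assume "y \<in> ksums k A"
    then obtain C where C: "C \<subseteq> {x, x + d + d}" "y = ?c + (\<Sum>z\<in>C. z - (x + d))"
      using ksums_single_repeated[OF assms(2), of k] unfolding S by blast
    have "C \<in> {{}, {x}, {x + d + d}, {x, x + d + d}}" using C(1) by blast
    then show "y \<in> {?c, ?c - d, ?c + d}" using C(2) dist by auto
  qed
  then have "card (ksums k A) \<le> card {?c, ?c - d, ?c + d}" by (rule card_mono[rotated]) simp
  also have "\<dots> \<le> 3" by (simp add: card_insert_if)
  finally show ?thesis .
qed

section \<open>Repeated terms, two-element supports and progressions with two centres\<close>

lemma ex_repeated:
  assumes "card (set_mset A) < size A"
  obtains a where "2 \<le> count A a" "a \<in># A"
proof -
  have "\<not> (\<forall>a\<in>#A. count A a \<le> 1)"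
  proof
    assume "\<forall>a\<in>#A. count A a \<le> 1"
    then have "size A \<le> (\<Sum>a\<in>set_mset A. 1)"
      unfolding size_multiset_overloaded_eq by (intro sum_mono) auto
    then show False using assms by simp
  qed
  then show thesis using that by (metis not_less_eq_eq numeral_2_eq_2 One_nat_def)
qed

text \<open>Two-element supports escape the induction: there \<open>card T = 1\<close>, and no index
  satisfies \<open>2 \<le> j \<le> card T\<close>. If both terms are repeated, two sums can suffice
  only when \<open>a + a = b + b\<close>, so that \<open>b - a\<close> is an involution.\<close>

lemma ksums_bound_pair:
  fixes A :: "'a::ab_group_add multiset"
  assumes k: "2 \<le> k" "k + 2 \<le> size A"
    and S: "set_mset A = {a, b}" "a \<noteq> b" and a: "2 \<le> count A a"
  shows "2 \<le> card (ksums k A)"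
    and "card (ksums k A) = 2 \<Longrightarrow> 2 \<le> count A b \<Longrightarrow> is_subgroup_coset {a, b}"
proof -
  have cb: "1 \<le> count A b" using S by (simp add: Suc_le_eq)
  have sub: "{#a, a, b#} \<subseteq># A"
    using a cb S by (intro mset_subset_eqI) auto
  have mem: "a + a \<in> ksums 2 {#a, a, b#}" "a + b \<in> ksums 2 {#a, a, b#}"
    using ksumsI[of "{#a, a#}" "{#a, a, b#}" 2] ksumsI[of "{#a, b#}" "{#a, a, b#}" 2]
    by (auto simp: add_mset_commute[of a b] add.commute[of a b])
  have "card {a + a, a + b} \<le> card (ksums 2 {#a, a, b#})" by (rule card_mono) (use mem in auto)
  also have "\<dots> \<le> card (ksums k A)" by (rule card_ksums_mono[OF sub]) (use k in auto)
  finally show "2 \<le> card (ksums k A)" using S by simp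
  assume eq: "card (ksums k A) = 2" and b: "2 \<le> count A b"
  have sub: "{#a, a, b, b#} \<subseteq># A"
    using a b S by (intro mset_subset_eqI) auto
  have mem: "a + a \<in> ksums 2 {#a, a, b, b#}" "a + b \<in> ksums 2 {#a, a, b, b#}"
    "b + b \<in> ksums 2 {#a, a, b, b#}"
    using ksumsI[of "{#a, a#}" "{#a, a, b, b#}" 2] ksumsI[of "{#a, b#}" "{#a, a, b, b#}" 2]
      ksumsI[of "{#b, b#}" "{#a, a, b, b#}" 2]
    by (auto simp: add_mset_commute[of a b] add.commute[of a b])
  have "card {a + a, a + b, b + b} \<le> card (ksums 2 {#a, a, b, b#})"
    by (rule card_mono) (use mem in auto)
  also have "\<dots> \<le> card (ksums k A)" by (rule card_ksums_mono[OF sub]) (use k in auto)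
  finally have "card {a + a, a + b, b + b} \<le> 2" using eq by simp
  then have ab: "a + a = b + b" using S(2) by (auto simp: card_insert_if split: if_splits)
  have "(b - a) + (b - a) = (b + b) - (a + a)" by (simp add: algebra_simps)
  then have dd: "(b - a) + (b - a) = 0" using ab by simp
  then have "- (b - a) = b - a" by (simp only: minus_unique)
  then have "is_subgroup {0, b - a}" using dd unfolding is_subgroup_def by auto
  moreover have "{a, b} = (\<lambda>h. a + h) ` {0, b - a}" by simp
  ultimately show "is_subgroup_coset {a, b}" unfolding is_subgroup_coset_def by blast
qed

lemma subgroup_coset_order_three:
  fixes a d :: "'a::ab_group_add"
  assumes "d + d + d = 0"
  shows "is_subgroup_coset {a, a + d, a - d}"
proof -
  have "d + d = - d" using assms by (simp add: eq_neg_iff_add_eq_0)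
  then have "is_subgroup {0, d, - d}"
    unfolding is_subgroup_def by (auto simp: algebra_simps)
  moreover have "{a, a + d, a - d} = (\<lambda>h. a + h) ` {0, d, - d}" by simp
  ultimately show ?thesis unfolding is_subgroup_coset_def by blast
qed

text \<open>The other centre is \<open>c = a + s\<close> with \<open>s = d\<close> or
  \<open>s = - d\<close>. Removing it leaves \<open>a\<close> and \<open>a - s\<close>, whose sum
  must be \<open>c + c\<close>; hence \<open>s + s + s = 0\<close>.\<close>

lemma two_centers_order_three:
  fixes a d e :: "'a::ab_group_add"
  assumes "{a, a + d, a - d} = {c, c + e, c - e}" "c \<noteq> a" "d \<noteq> - d"
  shows "d + d + d = 0"
proof -
  have main: "s + s + s = 0" if c: "c = a + s" "s = d \<or> s = - d" for s
  proof -
    have "{a, a + s, a - s} = {a, a + d, a - d}" using c(2) by (elim disjE) auto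
    then have eq: "{a, a + s, a - s} = {c, c + e, c - e}" using assms(1) by simp
    have s: "s \<noteq> - s" "s \<noteq> 0" using c assms(2,3) by auto
    have "e \<noteq> 0"
    proof
      assume "e = 0"
      then have "a \<in> {c}" using eq by auto
      then show False using assms(2) by blast
    qed
    then have "{c, c + e, c - e} - {c} = {c + e, c - e}" by auto
    moreover have "a - s \<noteq> a + s" using s(1) by (metis add_left_imp_eq uminus_add_conv_diff add.commute)
    then have "{a, a + s, a - s} - {a + s} = {a, a - s}" using s(2) by auto
    ultimately have "{a, a - s} = {c + e, c - e}" using eq c(1) by metis
    \<comment> \<open>Equal unordered pairs have equal sums.\<close>
    then have "a + (a - s) = (c + e) + (c - e)"
      by (elim doubleton_eq_iff[THEN iffD1, elim_format] disjE conjE) (simp_all add: add.commute)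
    then have "a + (a - s) = c + c" by simp
    then show ?thesis unfolding c(1) by (simp add: algebra_simps)
  qed
  have "c \<in> {a, a + d, a - d}" using assms(1) by blast
  then have "c = a + d \<or> c = a + (- d)" using assms(2) by auto
  then show ?thesis
  proof
    assume "c = a + (- d)"
    then have "- d + - d + - d = 0" by (intro main) auto
    then have "- (d + d + d) = 0" by (simp only: minus_add_distrib)
    then show ?thesis by (simp only: neg_equal_0_iff_equal)
  qed (auto intro: main)
qed

theorem theorem14:
  fixes A :: "'a::ab_group_add multiset" and k :: nat
  assumes "size A > card (set_mset A)"
    and "2 \<le> k" and "k + 2 \<le> size A"
  shows "card (ksums k A) \<ge> card (set_mset A) \<and>
    (card (ksums k A) = card (set_mset A) \<longleftrightarrow>
       is_subgroup_coset (set_mset A)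
     \<or> (card (set_mset A) = 2 \<and> card (mult_support 2 A) = 1)
     \<or> (\<exists>x d. distinct [x, x + d, x + d + d]
            \<and> set_mset A = {x, x + d, x + d + d}
            \<and> mult_support 2 A = {x + d}))"
    (is "?lower \<and> (?eq \<longleftrightarrow> ?i \<or> ?ii \<or> ?iii)")
proof -
  let ?S = "set_mset A"
  obtain a where a: "2 \<le> count A a" "a \<in># A" using ex_repeated[OF assms(1)] .
  have supp: "c \<in> mult_support 2 A \<longleftrightarrow> 2 \<le> count A c" for c
    by (cases "c \<in># A") (auto simp: mult_support_def not_in_iff)
  have lower: ?lower and forward: "?eq \<Longrightarrow> ?i \<or> ?ii \<or> ?iii"
  proof -
    have S0: "card ?S \<noteq> 0" using a by auto
    then consider "card ?S = 1" | "card ?S = 2" | "3 \<le> card ?S" by linarith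
    then have "?lower \<and> (?eq \<longrightarrow> ?i \<or> ?ii \<or> ?iii)"
    proof cases
      case 1
      then obtain c where c: "?S = {c}" by (rule card_1_singletonE)
      have "is_subgroup {0 :: 'a}" by (simp add: is_subgroup_def)
      moreover have "{c} = (\<lambda>h. c + h) ` {0}" by simp
      ultimately have ?i using c unfolding is_subgroup_coset_def by metis
      moreover obtain B where "B \<subseteq># A" "size B = k"
        using ex_submultiset_size[of k A] assms(3) by auto
      then have "ksums k A \<noteq> {}" using ksumsI by blast
      then have "1 \<le> card (ksums k A)" by (simp add: Suc_le_eq card_gt_0_iff)
      ultimately show ?thesis using 1 by simp
    next
      case 2
      then have "card (?S - {a}) = 1" using a(2) by simp
      then obtain b where "?S - {a} = {b}" by (rule card_1_singletonE)
      then have b: "?S = {a, b}" "a \<noteq> b" using a(2) by auto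
      have "?i \<or> ?ii" if ?eq
      proof (cases "2 \<le> count A b")
        case True
        then show ?thesis using ksums_bound_pair(2)[OF assms(2,3) b a(1)] that 2 b by simp
      next
        case False
        have "mult_support 2 A = {a}" using False a b supp unfolding mult_support_def by auto
        then show ?thesis using 2 by simp
      qed
      then show ?thesis using ksums_bound_pair(1)[OF assms(2,3) b a(1)] 2 by auto
    next
      case 3
      note bnd = ksums_bound_repeated[OF assms(2,3) 3]
      have "?i \<or> ?iii" if eq: ?eq
      proof (cases ?i)
        case False
        obtain d where d: "d \<noteq> - d" "?S = {a, a + d, a - d}"
          using bnd(2)[OF a(1) eq] False by blast
        \<comment> \<open>Every repeated term is a centre of the progression; a second centre would
          make \<open>d\<close> of order three and the support a coset.\<close>
        have "c = a" if c: "2 \<le> count A c" for c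
        proof (rule ccontr)
          assume "c \<noteq> a"
          moreover obtain e where "?S = {c, c + e, c - e}"
            using bnd(2)[OF c eq] False by blast
          ultimately have "d + d + d = 0" using two_centers_order_three d by metis
          then show False using subgroup_coset_order_three[of d a] d(2) False by simp
        qed
        then have supp1: "mult_support 2 A = {a}" using supp a(1) by blast
        have "distinct [a - d, a - d + d, a - d + d + d]"
          using d(1) by (auto simp: algebra_simps eq_neg_iff_add_eq_0)
        moreover have "?S = {a - d, a - d + d, a - d + d + d}" using d(2) by auto
        moreover have "mult_support 2 A = {a - d + d}" using supp1 by simp
        ultimately show ?thesis by blast
      qed simp
      then show ?thesis using bnd(1)[OF a(1)] by blast
    qed
    then show ?lower and "?eq \<Longrightarrow> ?i \<or> ?ii \<or> ?iii" by blast+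
  qed
  \<comment> \<open>Given the lower bound, the converse needs only the opposite inequality.\<close>
  have "card (ksums k A) \<le> card ?S" if "?i \<or> ?ii \<or> ?iii"
    using that
  proof (elim disjE)
    assume ?i
    then show ?thesis by (rule ksums_subgroup_coset_card)
  next
    assume ?ii
    then show ?thesis using ksums_two_elements_card[of A k] by simp
  next
    assume ?iii
    then obtain x d where xd: "distinct [x, x + d, x + d + d]" "?S = {x, x + d, x + d + d}"
      "mult_support 2 A = {x + d}" by blast
    have "card ?S = 3" using distinct_card[OF xd(1)] xd(2) by simp
    then show ?thesis using ksums_three_term_progression_card[OF xd(2,3,1), of k] by simp
  qed
  then show ?thesis using lower forward by (meson le_antisym)
qed

end
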